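(* Let $p\ge 1$ and let $\mathcal S=(S_n)_{n\ge 0}$ be a linearly recursive matrix sequence of order $3$ with $S_0=I_p$, $S_1,S_2\in\mathcal M_p(\mathbb R)$ symmetric, and with minimal polynomial $P_{\mathcal S}(X)=(X-\lambda_0)(X-\lambda_1)(X-\lambda_2)$, where $\lambda_0<\lambda_1<\lambda_2$ are real. Let $\mu=T_0\delta_{\lambda_0}+T_1\delta_{\lambda_1}+T_2\delta_{\lambda_2}$, with $T_0,T_1,T_2\in\mathcal M_p(\mathbb R)$, be the associated finitely atomic representing matrix charge of $\mathcal S$; that is, $T_0,T_1,T_2$ are determined by $$T_0+T_1+T_2=I_p,\quad \lambda_0T_0+\lambda_1T_1+\lambda_2T_2=S_1,\quad \lambda_0^2T_0+\lambda_1^2T_1+\lambda_2^2T_2=S_2.$$ The following statements are equivalent: (1) $\mu$ is a matrix measure; (2) $S_2-(\lambda_1+\lambda_2)S_1+\lambda_1\lambda_2I_p\succeq 0$, $\;-S_2+(\lambda_0+\lambda_2)S_1-\lambda_0\lambda_2I_p\succeq 0$, and $S_2-(\lambda_0+\lambda_1)S_1+\lambda_0\lambda_1I_p\succeq 0$; (3) $\lambda_1(S_1-\lambda_2I_p)\preceq S_2-\lambda_2S_1\preceq\lambda_0(S_1-\lambda_2I_p)$ and $\lambda_1(S_1-\lambda_0I_p)\preceq S_2-\lambda_0S_1\preceq\lambda_2(S_1-\lambda_0I_p)$.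
   Context: $\mathcal M_p(\mathbb R)$ is the algebra of real $p\times p$ matrices and $I_p$ the identity. $A\preceq B$ (equivalently $B-A\succeq 0$) means $B-A$ is symmetric positive semidefinite. A sequence $\mathcal S=(S_n)_{n\ge 0}$ in $\mathcal M_p(\mathbb R)$ is a linearly recursive matrix sequence if there are an integer $m\ge 1$ and real numbers $a_0,\dots,a_{m-1}$ with $a_{m-1}\ne 0$ such that $S_{n+1}=a_0S_n+\dots+a_{m-1}S_{n-m+1}$ for all $n\ge m-1$. Every polynomial $X^m-a_0X^{m-1}-\dots-a_{m-1}$ arising from such a recurrence satisfied by $\mathcal S$ is a characteristic polynomial of $\mathcal S$. The linear span of all characteristic polynomials is an ideal of $\mathbb R[X]$; the minimal polynomial $P_{\mathcal S}$ is its unique monic generator, and the order of $\mathcal S$ is $\deg P_{\mathcal S}$. A representing matrix charge satisfies $S_n=\int x^n\,d\mu(x)$ for all $n\ge 0$, where a matrix charge is a map on the Borel sets of $\mathbb R$ with values in $\mathcal M_p(\mathbb R)$ whose entries are finite signed measures. A matrix measure is a matrix charge $\mu$ such that $\mu(B)$ is symmetric positive semidefinite for every Borel set $B$. *)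

theory Defs
  imports "HOL-Analysis.Analysis" "HOL-Computational_Algebra.Polynomial"
begin

text \<open>Linearly recursive matrix sequences. As in the source, the last coefficient \<open>a (m - 1)\<close> of a
  recurrence is required to be nonzero, so 0 is never a root of a characteristic polynomial.\<close>

definition satisfies_recurrence ::
    "(nat \<Rightarrow> real ^ 'p ^ 'p) \<Rightarrow> nat \<Rightarrow> (nat \<Rightarrow> real) \<Rightarrow> bool" where
  "satisfies_recurrence S m a \<longleftrightarrow> m \<ge> 1 \<and> a (m - 1) \<noteq> 0 \<and>
     (\<forall>n\<ge>m - 1. S (n + 1) = (\<Sum>i<m. a i *\<^sub>R S (n - i)))"

definition linearly_recursive :: "(nat \<Rightarrow> real ^ 'p ^ 'p) \<Rightarrow> bool" where
  "linearly_recursive S \<longleftrightarrow> (\<exists>m a. satisfies_recurrence S m a)"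

definition recurrence_poly :: "nat \<Rightarrow> (nat \<Rightarrow> real) \<Rightarrow> real poly" where
  "recurrence_poly m a = monom 1 m - (\<Sum>i<m. monom (a i) (m - 1 - i))"

definition characteristic_polys :: "(nat \<Rightarrow> real ^ 'p ^ 'p) \<Rightarrow> real poly set" where
  "characteristic_polys S = {recurrence_poly m a | m a. satisfies_recurrence S m a}"

definition characteristic_ideal :: "(nat \<Rightarrow> real ^ 'p ^ 'p) \<Rightarrow> real poly set" where
  "characteristic_ideal S = module.span smult (characteristic_polys S)"

text \<open>The set \<open>{Q. P dvd Q}\<close> is the principal ideal generated by \<open>P\<close>. The description is well defined
  for linearly recursive sequences; see \<open>minimal_poly_generates\<close> below.\<close>

definition minimal_poly :: "(nat \<Rightarrow> real ^ 'p ^ 'p) \<Rightarrow> real poly" where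
  "minimal_poly S = (THE P. lead_coeff P = 1 \<and> characteristic_ideal S = {Q. P dvd Q})"

definition recursion_order :: "(nat \<Rightarrow> real ^ 'p ^ 'p) \<Rightarrow> nat" where
  "recursion_order S = degree (minimal_poly S)"

definition pos_semidef :: "real ^ 'p ^ 'p \<Rightarrow> bool" where
  "pos_semidef A \<longleftrightarrow> transpose A = A \<and> (\<forall>x. 0 \<le> x \<bullet> (A *v x))"

definition loewner_le :: "real ^ 'p ^ 'p \<Rightarrow> real ^ 'p ^ 'p \<Rightarrow> bool"  (infix "\<preceq>" 50) where
  "A \<preceq> B \<longleftrightarrow> pos_semidef (B - A)"

text \<open>Charges are functions on all sets of reals; only their values on Borel sets are constrained.\<close>

definition finite_signed_measure :: "(real set \<Rightarrow> real) \<Rightarrow> bool" where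
  "finite_signed_measure \<nu> \<longleftrightarrow> \<nu> {} = 0 \<and>
     (\<forall>A :: nat \<Rightarrow> real set. range A \<subseteq> sets borel \<longrightarrow> disjoint_family A \<longrightarrow>
        (\<lambda>n. \<nu> (A n)) sums \<nu> (\<Union>n. A n))"

definition matrix_charge :: "(real set \<Rightarrow> real ^ 'p ^ 'p) \<Rightarrow> bool" where
  "matrix_charge \<mu> \<longleftrightarrow> (\<forall>i j. finite_signed_measure (\<lambda>B. \<mu> B $ i $ j))"

definition matrix_measure :: "(real set \<Rightarrow> real ^ 'p ^ 'p) \<Rightarrow> bool" where
  "matrix_measure \<mu> \<longleftrightarrow> matrix_charge \<mu> \<and> (\<forall>B\<in>sets borel. pos_semidef (\<mu> B))"

definition dirac :: "real \<Rightarrow> real set \<Rightarrow> real" where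
  "dirac x B = indicator B x"

text \<open>Well-definedness of the minimal polynomial: the characteristic ideal is the set of all
  polynomials \<open>Q\<close> that annihilate \<open>S\<close> when \<open>X\<close> acts as the shift.\<close>

lemma module_smult: "module (smult :: real \<Rightarrow> real poly \<Rightarrow> real poly)"
  by unfold_locales (auto simp: smult_add_right smult_add_left)

definition shift_apply :: "(nat \<Rightarrow> real ^ 'p ^ 'p) \<Rightarrow> real poly \<Rightarrow> nat \<Rightarrow> real ^ 'p ^ 'p" where
  "shift_apply S Q n = (\<Sum>i\<le>degree Q. coeff Q i *\<^sub>R S (n + i))"

lemma shift_apply_bound:
  assumes "degree Q \<le> N"
  shows "shift_apply S Q n = (\<Sum>i\<le>N. coeff Q i *\<^sub>R S (n + i))"
  unfolding shift_apply_def using assms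
  by (intro sum.mono_neutral_left) (auto simp: coeff_eq_0)

lemma shift_apply_0 [simp]: "shift_apply S 0 n = 0"
  by (simp add: shift_apply_def)

lemma shift_apply_add: "shift_apply S (P + Q) n = shift_apply S P n + shift_apply S Q n"
proof -
  let ?N = "max (degree P) (degree Q)"
  have "degree (P + Q) \<le> ?N" by (simp add: degree_add_le)
  then show ?thesis
    by (simp add: shift_apply_bound[where N = ?N] scaleR_add_left sum.distrib)
qed

lemma shift_apply_smult: "shift_apply S (smult c Q) n = c *\<^sub>R shift_apply S Q n"
  by (simp add: shift_apply_bound[where N = "degree Q"] scaleR_sum_right)

lemma shift_apply_diff: "shift_apply S (P - Q) n = shift_apply S P n - shift_apply S Q n"
  using shift_apply_add[of S P "smult (-1) Q" n] shift_apply_smult[of S "-1" Q n] by simp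

lemma shift_apply_sum:
  "shift_apply S (\<Sum>i\<in>I. f i) n = (\<Sum>i\<in>I. shift_apply S (f i) n)"
  by (induction I rule: infinite_finite_induct) (simp_all add: shift_apply_add)

lemma shift_apply_monom: "shift_apply S (monom c k) n = c *\<^sub>R S (n + k)"
proof -
  have "shift_apply S (monom c k) n = (\<Sum>i\<le>k. coeff (monom c k) i *\<^sub>R S (n + i))"
    by (rule shift_apply_bound) (rule degree_monom_le)
  also have "\<dots> = (\<Sum>i\<le>k. if i = k then c *\<^sub>R S (n + k) else 0)"
    by (intro sum.cong) auto
  finally show ?thesis by simp
qed

lemma shift_apply_pCons:
  "shift_apply S (pCons a Q) n = a *\<^sub>R S n + shift_apply S Q (Suc n)"
proof -
  have "shift_apply S (pCons a Q) n =
      (\<Sum>i\<le>Suc (degree Q). coeff (pCons a Q) i *\<^sub>R S (n + i))"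
    by (rule shift_apply_bound) (simp add: degree_pCons_le)
  also have "\<dots> = a *\<^sub>R S n + shift_apply S Q (Suc n)"
    by (subst sum.atMost_Suc_shift) (simp add: shift_apply_def)
  finally show ?thesis .
qed

lemma shift_apply_mult:
  assumes "\<And>n. shift_apply S Q n = 0"
  shows "shift_apply S (R * Q) n = 0"
proof (induction R arbitrary: n)
  case (pCons a R)
  then show ?case
    using assms by (simp add: shift_apply_add shift_apply_smult shift_apply_pCons)
qed simp

lemma characteristic_polys_iff:
  "Q \<in> characteristic_polys S \<longleftrightarrow>
     degree Q \<ge> 1 \<and> lead_coeff Q = 1 \<and> coeff Q 0 \<noteq> 0 \<and> (\<forall>n. shift_apply S Q n = 0)"
  (is "_ \<longleftrightarrow> ?R")
proof -
  have coeff_rp: "coeff (recurrence_poly m a) k =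
      (if k = m then 1 else if k < m then - a (m - 1 - k) else 0)" for m k :: nat and a
  proof -
    have "(\<Sum>i<m. coeff (monom (a i) (m - 1 - i)) k) =
        (\<Sum>i<m. if i = m - 1 - k then (if k < m then a (m - 1 - k) else 0) else 0)"
      by (intro sum.cong) auto
    also have "\<dots> = (if k < m then a (m - 1 - k) else 0)"
      by auto
    finally show ?thesis
      by (auto simp: recurrence_poly_def coeff_sum)
  qed
  have degree_rp: "degree (recurrence_poly m a) = m" for m :: nat and a
  proof (rule antisym)
    show "degree (recurrence_poly m a) \<le> m" by (rule degree_le) (auto simp: coeff_rp)
    show "m \<le> degree (recurrence_poly m a)" by (rule le_degree) (simp add: coeff_rp)
  qed
  have apply_rp: "shift_apply S (recurrence_poly m a) n =
      S (n + m) - (\<Sum>i<m. a i *\<^sub>R S (n + (m - 1 - i)))" for m n :: nat and a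
    by (simp add: recurrence_poly_def shift_apply_diff shift_apply_sum shift_apply_monom)
  have all_ge: "(\<forall>n\<ge>k. R n) \<longleftrightarrow> (\<forall>n. R (n + k))" for k :: nat and R
    by (metis le_add2 le_add_diff_inverse2)
  have rec_iff: "(\<forall>n\<ge>m - 1. S (n + 1) = (\<Sum>i<m. a i *\<^sub>R S (n - i))) \<longleftrightarrow>
      (\<forall>n. shift_apply S (recurrence_poly m a) n = 0)" if m: "m \<ge> 1" for m :: nat and a
  proof -
    have "(\<forall>n\<ge>m - 1. S (n + 1) = (\<Sum>i<m. a i *\<^sub>R S (n - i))) \<longleftrightarrow>
        (\<forall>n. S (n + (m - 1) + 1) = (\<Sum>i<m. a i *\<^sub>R S (n + (m - 1) - i)))"
      by (rule all_ge)
    also have "\<dots> \<longleftrightarrow> (\<forall>n. shift_apply S (recurrence_poly m a) n = 0)"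
    proof -
      have "(\<Sum>i<m. a i *\<^sub>R S (n + (m - 1) - i)) = (\<Sum>i<m. a i *\<^sub>R S (n + (m - 1 - i)))" for n
        by (intro sum.cong) auto
      then show ?thesis using m by (simp add: apply_rp)
    qed
    finally show ?thesis .
  qed
  show ?thesis
  proof
    assume "Q \<in> characteristic_polys S"
    then obtain m a where "Q = recurrence_poly m a" "satisfies_recurrence S m a"
      by (auto simp: characteristic_polys_def)
    then show ?R
      using rec_iff[of m a] by (auto simp: satisfies_recurrence_def degree_rp coeff_rp)
  next
    assume R: ?R
    define a where "a = (\<lambda>i. - coeff Q (degree Q - 1 - i))"
    have Q: "Q = recurrence_poly (degree Q) a"
      using R by (intro poly_eqI) (auto simp: coeff_rp a_def coeff_eq_0)
    have "satisfies_recurrence S (degree Q) a"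
      using R rec_iff[of "degree Q" a] Q by (auto simp: satisfies_recurrence_def a_def)
    with Q show "Q \<in> characteristic_polys S"
      by (auto simp: characteristic_polys_def)
  qed
qed

lemma characteristic_ideal_principal:
  assumes "linearly_recursive S"
  obtains P where "lead_coeff P = 1" "characteristic_ideal S = {Q. P dvd Q}"
proof -
  interpret module "smult :: real \<Rightarrow> real poly \<Rightarrow> real poly" by (rule module_smult)
  define I where "I = {Q. \<forall>n. shift_apply S Q n = 0}"
  obtain C where C: "C \<in> characteristic_polys S"
    using assms by (auto simp: linearly_recursive_def characteristic_polys_def)
  then have CI: "C \<in> I" "C \<noteq> 0" "coeff C 0 \<noteq> 0"
    by (auto simp: characteristic_polys_iff I_def)
  obtain P0 where P0: "P0 \<in> I" "P0 \<noteq> 0"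
    and least: "\<And>Q. Q \<in> I \<Longrightarrow> Q \<noteq> 0 \<Longrightarrow> degree P0 \<le> degree Q"
    using CI ex_has_least_nat[of "\<lambda>Q. Q \<in> I \<and> Q \<noteq> 0" C degree] by auto
  define P where "P = smult (inverse (lead_coeff P0)) P0"
  have P: "P \<in> I" "P \<noteq> 0" "lead_coeff P = 1" "degree P = degree P0"
    using P0 by (auto simp: P_def I_def shift_apply_smult)
  have I: "I = {Q. P dvd Q}"
  proof (intro equalityI subsetI)
    fix Q assume "Q \<in> I"
    have "Q mod P = Q - (Q div P) * P" by (simp add: minus_div_mult_eq_mod)
    also have "\<dots> \<in> I"
      using \<open>Q \<in> I\<close> P(1) by (auto simp: I_def shift_apply_diff shift_apply_mult)
    finally have "Q mod P \<in> I" .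
    then have "Q mod P = 0"
      using least[of "Q mod P"] degree_mod_less[of P Q] P by force
    then show "Q \<in> {Q. P dvd Q}" by (simp add: mod_eq_0_iff_dvd)
  next
    fix Q assume "Q \<in> {Q. P dvd Q}"
    then show "Q \<in> I"
      using P(1) by (auto simp: I_def shift_apply_mult mult.commute elim!: dvdE)
  qed
  have P_0: "coeff P 0 \<noteq> 0"
    using CI I by (auto simp: coeff_mult_0 elim!: dvdE)
  have char: "(monom 1 (Suc k) + [:c:]) * P \<in> characteristic_polys S" if "c \<noteq> 0" for k c
  proof -
    have deg: "degree (monom 1 (Suc k) + [:c:]) = Suc k"
      by (subst degree_add_eq_left) (auto simp: degree_monom_eq)
    then have lc: "lead_coeff (monom 1 (Suc k) + [:c:]) = 1" by simp
    then have "monom 1 (Suc k) + [:c:] \<noteq> 0" by force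
    then have "1 \<le> degree ((monom 1 (Suc k) + [:c:]) * P)"
      using P(2) deg by (simp add: degree_mult_eq)
    moreover have "lead_coeff ((monom 1 (Suc k) + [:c:]) * P) = 1"
      using lc P(3) by (simp only: lead_coeff_mult)
    moreover have "coeff ((monom 1 (Suc k) + [:c:]) * P) 0 \<noteq> 0"
      using P_0 that by (simp add: coeff_mult_0)
    moreover have "\<forall>n. shift_apply S ((monom 1 (Suc k) + [:c:]) * P) n = 0"
      using P(1) by (intro allI shift_apply_mult) (auto simp: I_def)
    ultimately show ?thesis unfolding characteristic_polys_iff by blast
  qed
  let ?V = "span (characteristic_polys S)"
  have P_V: "P \<in> ?V"
  proof -
    have "(monom 1 (Suc 0) + [:2:]) * P - (monom 1 (Suc 0) + [:1:]) * P \<in> ?V"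
      by (intro span_diff span_base char) auto
    moreover have "(monom 1 (Suc 0) + [:2:]) * P - (monom 1 (Suc 0) + [:1:]) * P = P"
      by (simp add: algebra_simps poly_eq_iff)
    ultimately show ?thesis by simp
  qed
  have monom_V: "monom 1 k * P \<in> ?V" for k
  proof (cases k)
    case 0
    then show ?thesis using P_V by (simp add: monom_0)
  next
    case (Suc j)
    have "(monom 1 (Suc j) + [:1:]) * P - P \<in> ?V"
      by (intro span_diff span_base char P_V) auto
    then show ?thesis by (simp add: Suc algebra_simps)
  qed
  have "?V = I"
  proof (intro equalityI)
    show "?V \<subseteq> I"
    proof (rule span_minimal)
      show "characteristic_polys S \<subseteq> I" by (auto simp: characteristic_polys_iff I_def)
      show "subspace I"
        by (auto simp: subspace_def I_def shift_apply_add shift_apply_smult)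
    qed
    show "I \<subseteq> ?V"
    proof
      fix Q assume "Q \<in> I"
      then have "P dvd Q" using I by simp
      then obtain R where "Q = R * P" by (metis dvdE mult.commute)
      also have "R * P = (\<Sum>i\<le>degree R. monom (coeff R i) i) * P"
        by (simp only: poly_as_sum_of_monoms)
      also have "\<dots> = (\<Sum>i\<le>degree R. smult (coeff R i) (monom 1 i * P))"
        unfolding sum_distrib_right
      proof (intro sum.cong refl)
        fix i
        have "monom (coeff R i) i = smult (coeff R i) (monom 1 i)" by (simp add: smult_monom)
        then show "monom (coeff R i) i * P = smult (coeff R i) (monom 1 i * P)" by simp
      qed
      also have "\<dots> \<in> ?V" by (intro span_sum span_scale monom_V)
      finally show "Q \<in> ?V" .
    qed
  qed
  then show thesis using that[of P] P(3) I by (simp add: characteristic_ideal_def)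
qed

lemma minimal_poly_generates:
  assumes "linearly_recursive S"
  shows "lead_coeff (minimal_poly S) = 1"
    and "characteristic_ideal S = {Q. minimal_poly S dvd Q}"
proof -
  obtain P where P: "lead_coeff P = 1" "characteristic_ideal S = {Q. P dvd Q}"
    using characteristic_ideal_principal[OF assms] .
  have unique: "P' = P" if "lead_coeff P' = 1 \<and> characteristic_ideal S = {Q. P' dvd Q}" for P'
  proof -
    have "P dvd P'" "P' dvd P" using P that by auto
    then obtain Q where Q: "P' = P * Q" by blast
    have "P \<noteq> 0" "Q \<noteq> 0" using P(1) that Q by force+
    then have "degree Q = 0"
      using dvd_imp_degree_le[OF \<open>P' dvd P\<close>] by (simp add: Q degree_mult_eq)
    then obtain c where "Q = [:c:]" by (rule degree_eq_zeroE)
    moreover have "lead_coeff Q = 1" using Q P(1) that by (simp add: lead_coeff_mult)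
    ultimately show ?thesis using Q by simp
  qed
  have "minimal_poly S = P"
    unfolding minimal_poly_def
  proof (rule the_equality)
    show "lead_coeff P = 1 \<and> characteristic_ideal S = {Q. P dvd Q}"
      by (intro conjI P)
  qed (rule unique)
  then show "lead_coeff (minimal_poly S) = 1"
    and "characteristic_ideal S = {Q. minimal_poly S dvd Q}"
    using P by simp_all
qed

end

theory Submission
  imports Defs
begin

text \<open>Solving the Vandermonde system for the atoms, each expression in the second and third
  conditions is a positive multiple of one of \<open>T0\<close>, \<open>T1\<close>, \<open>T2\<close>. The charge takes these values on
  the singletons of its atoms, so it is a matrix measure iff all three are positive semidefinite.\<close>

lemma pos_semidef_add:
  assumes "pos_semidef A" "pos_semidef B"
  shows "pos_semidef (A + B)"
  using assms
  by (simp add: pos_semidef_def transpose_def vec_eq_iff matrix_vector_mult_add_rdistrib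
      inner_add_right)

lemma pos_semidef_scaleR:
  assumes "pos_semidef A" "0 \<le> c"
  shows "pos_semidef (c *\<^sub>R A)"
  using assms
  by (simp add: pos_semidef_def transpose_def vec_eq_iff flip: scaleR_matrix_vector_assoc)

text \<open>Scaling back by \<open>inverse c\<close> gives the converse. This removes the positive
  factors that appear when the Vandermonde system is solved.\<close>

lemma pos_semidef_scaleR_iff:
  assumes "0 < c"
  shows "pos_semidef (c *\<^sub>R A) \<longleftrightarrow> pos_semidef A"
  using pos_semidef_scaleR[of A c] pos_semidef_scaleR[of "c *\<^sub>R A" "inverse c"] assms
  by auto

text \<open>At most one member of a disjoint family contains \<open>x\<close>, so the series of
  indicators has at most one nonzero term.\<close>

lemma finite_signed_measure_dirac: "finite_signed_measure (dirac x)"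
  unfolding finite_signed_measure_def dirac_def disjoint_family_on_def
  by (auto intro!: indicator_sums)

lemma finite_signed_measure_add:
  assumes "finite_signed_measure \<nu>" "finite_signed_measure \<nu>'"
  shows "finite_signed_measure (\<lambda>B. \<nu> B + \<nu>' B)"
  using assms by (simp add: finite_signed_measure_def sums_add)

text \<open>The constant stands on the right because an entry of
  \<open>dirac l B *\<^sub>R T\<close> is \<open>dirac l B * T $ i $ j\<close>.\<close>

lemma finite_signed_measure_mult_right:
  assumes "finite_signed_measure \<nu>"
  shows "finite_signed_measure (\<lambda>B. \<nu> B * c)"
  using assms by (simp add: finite_signed_measure_def sums_mult2)

lemma matrix_measure_three_atoms_iff:
  fixes T0 T1 T2 :: "real ^ 'p ^ 'p"
  assumes "l0 \<noteq> l1" "l0 \<noteq> l2" "l1 \<noteq> l2"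
  defines "\<mu> \<equiv> \<lambda>B. dirac l0 B *\<^sub>R T0 + dirac l1 B *\<^sub>R T1 + dirac l2 B *\<^sub>R T2"
  shows "matrix_measure \<mu> \<longleftrightarrow> pos_semidef T0 \<and> pos_semidef T1 \<and> pos_semidef T2"
proof
  assume "matrix_measure \<mu>"
  then have "pos_semidef (\<mu> {l})" for l
    by (simp add: matrix_measure_def)
  moreover have "\<mu> {l0} = T0" "\<mu> {l1} = T1" "\<mu> {l2} = T2"
    using assms(1-3) by (simp_all add: \<mu>_def dirac_def)
  ultimately show "pos_semidef T0 \<and> pos_semidef T1 \<and> pos_semidef T2"
    by metis
next
  assume T: "pos_semidef T0 \<and> pos_semidef T1 \<and> pos_semidef T2"
  have "matrix_charge \<mu>"
    by (simp add: matrix_charge_def \<mu>_def finite_signed_measure_add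
        finite_signed_measure_mult_right finite_signed_measure_dirac)
  \<comment> \<open>Each \<open>dirac\<close> value is 0 or 1, so \<open>\<mu> B\<close> is the sum
    of those weights whose atoms lie in \<open>B\<close>.\<close>
  moreover have "pos_semidef (\<mu> B)" for B
    using T by (simp add: \<mu>_def dirac_def pos_semidef_add pos_semidef_scaleR)
  ultimately show "matrix_measure \<mu>"
    by (simp add: matrix_measure_def)
qed

theorem proposition4p12:
  fixes S :: "nat \<Rightarrow> real ^ 'p ^ 'p"
    and l0 l1 l2 :: real
    and T0 T1 T2 :: "real ^ 'p ^ 'p"
    and \<mu> :: "real set \<Rightarrow> real ^ 'p ^ 'p"
  assumes "linearly_recursive S"
    and "recursion_order S = 3"
    and "S 0 = mat 1"
    and "transpose (S 1) = S 1"
    and "transpose (S 2) = S 2"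
    and "l0 < l1" and "l1 < l2"
    and "minimal_poly S = [:- l0, 1:] * [:- l1, 1:] * [:- l2, 1:]"
    and "T0 + T1 + T2 = mat 1"
    and "l0 *\<^sub>R T0 + l1 *\<^sub>R T1 + l2 *\<^sub>R T2 = S 1"
    and "l0\<^sup>2 *\<^sub>R T0 + l1\<^sup>2 *\<^sub>R T1 + l2\<^sup>2 *\<^sub>R T2 = S 2"
    and "\<mu> = (\<lambda>B. dirac l0 B *\<^sub>R T0 + dirac l1 B *\<^sub>R T1 + dirac l2 B *\<^sub>R T2)"
  shows "(matrix_measure \<mu> \<longleftrightarrow>
            pos_semidef (S 2 - (l1 + l2) *\<^sub>R S 1 + (l1 * l2) *\<^sub>R mat 1) \<and>
            pos_semidef (- S 2 + (l0 + l2) *\<^sub>R S 1 - (l0 * l2) *\<^sub>R mat 1) \<and>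
            pos_semidef (S 2 - (l0 + l1) *\<^sub>R S 1 + (l0 * l1) *\<^sub>R mat 1))
       \<and> (matrix_measure \<mu> \<longleftrightarrow>
            l1 *\<^sub>R (S 1 - l2 *\<^sub>R mat 1) \<preceq> S 2 - l2 *\<^sub>R S 1 \<and>
            S 2 - l2 *\<^sub>R S 1 \<preceq> l0 *\<^sub>R (S 1 - l2 *\<^sub>R mat 1) \<and>
            l1 *\<^sub>R (S 1 - l0 *\<^sub>R mat 1) \<preceq> S 2 - l0 *\<^sub>R S 1 \<and>
            S 2 - l0 *\<^sub>R S 1 \<preceq> l2 *\<^sub>R (S 1 - l0 *\<^sub>R mat 1))"
proof -
  note moments = assms(9-11)[symmetric]
  let ?E0 = "S 2 - (l1 + l2) *\<^sub>R S 1 + (l1 * l2) *\<^sub>R mat 1"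
  let ?E1 = "- S 2 + (l0 + l2) *\<^sub>R S 1 - (l0 * l2) *\<^sub>R mat 1"
  let ?E2 = "S 2 - (l0 + l1) *\<^sub>R S 1 + (l0 * l1) *\<^sub>R mat 1"
  \<comment> \<open>Replacing \<open>X^k\<close> by the k-th moment sends a quadratic
    \<open>q\<close> to the sum of \<open>q(lj) *\<^sub>R Tj\<close>. Each expression arises from
    the quadratic, up to sign, that vanishes at the other two nodes, so a single weight survives.
    For \<open>?E1\<close> it is \<open>-(X - l0) * (X - l2)\<close>: the sign makes the value at
    the middle node positive.\<close>
  have "?E0 = ((l1 - l0) * (l2 - l0)) *\<^sub>R T0" "?E1 = ((l1 - l0) * (l2 - l1)) *\<^sub>R T1"
    "?E2 = ((l2 - l0) * (l2 - l1)) *\<^sub>R T2"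
    unfolding moments by (simp_all add: algebra_simps power2_eq_square)
  then have E: "pos_semidef ?E0 \<longleftrightarrow> pos_semidef T0" "pos_semidef ?E1 \<longleftrightarrow> pos_semidef T1"
    "pos_semidef ?E2 \<longleftrightarrow> pos_semidef T2"
    using assms(6,7) by (simp_all add: pos_semidef_scaleR_iff)
  have mu: "matrix_measure \<mu> \<longleftrightarrow> pos_semidef T0 \<and> pos_semidef T1 \<and> pos_semidef T2"
    unfolding assms(12) using assms(6,7) by (intro matrix_measure_three_atoms_iff) auto
  \<comment> \<open>The four Loewner differences give only three matrices: both upper bounds lead to
    \<open>?E1\<close>, while the lower bounds lead to \<open>?E0\<close> and
    \<open>?E2\<close>.\<close>
  have D: "S 2 - l2 *\<^sub>R S 1 - l1 *\<^sub>R (S 1 - l2 *\<^sub>R mat 1) = ?E0"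
    "l0 *\<^sub>R (S 1 - l2 *\<^sub>R mat 1) - (S 2 - l2 *\<^sub>R S 1) = ?E1"
    "S 2 - l0 *\<^sub>R S 1 - l1 *\<^sub>R (S 1 - l0 *\<^sub>R mat 1) = ?E2"
    "l2 *\<^sub>R (S 1 - l0 *\<^sub>R mat 1) - (S 2 - l0 *\<^sub>R S 1) = ?E1"
    by (simp_all add: algebra_simps)
  show ?thesis
    unfolding loewner_le_def D E mu by blast
qed

end
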